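(* For every bounded first-order language $\mathcal{L}$ (over a signature $\Sigma$ and variable set $V$), the subsumption relation $\sqsubseteq_{\mathcal{L}}$ is a preorder on $\mathcal{L}$ (i.e., reflexive and transitive); for all $\phi,\psi\in\mathcal{L}$, if $\phi\sqsubseteq_{\mathcal{L}}\psi$ then $\phi\models\psi$ (every state satisfying $\phi$ satisfies $\psi$); and $\bot_{\mathcal{L}}\sqsubseteq_{\mathcal{L}}\phi$ for every $\phi\in\mathcal{L}$.
   Context: Fix a first-order signature $\Sigma$ and a set of variables $V$. A state is a pair $s=((\mathcal{U},\mathcal{I}),\mu)$ where $(\mathcal{U},\mathcal{I})$ is a $\Sigma$-structure with a finite universe $\mathcal{U}$ and $\mu$ assigns elements of $\mathcal{U}$ to the variables; $s\models\phi$ is standard first-order satisfaction, where $\bot$ is a formula never satisfied, $\bigvee\langle\phi_1,\dots,\phi_n\rangle$ and $\bigwedge\langle\phi_1,\dots,\phi_n\rangle$ denote the disjunction/conjunction of the sequence, and the empty disjunction $\bigvee\epsilon$ is equivalent to $\bot$. For a finite $X\subseteq V$, $\mathfrak{S}_X$ is the set of permutations of $X$, and $\phi\pi$ denotes the formula obtained by substituting each free variable $x\in X$ of $\phi$ by $\pi(x)$. A set $F$ of formulas is $\mathfrak{S}_V$-closed if $\phi\pi\in F$ whenever $\phi\in F$ and $\pi$ is a permutation of a finite subset of $V$. For a sequence $\bar\phi=\langle\phi_1,\dots,\phi_n\rangle$, $|\bar\phi|=n$, $[\bar\phi]=\{1,\dots,n\}$, $\epsilon$ is the empty sequence and $\mathcal{L}^*$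 is the set of finite sequences of elements of $\mathcal{L}$. Bounded first-order languages, each equipped with a designated formula $\bot_{\mathcal{L}}$, are defined inductively (with $X\subseteq V$ finite, $\mathcal{L},\mathcal{L}_1,\mathcal{L}_2$ bounded languages): (1) $\mathcal{L}_A=A\cup\{\bot\}$ with $\bot_{\mathcal{L}_A}=\bot$, for any finite $\mathfrak{S}_V$-closed set $A$ of formulas over $\Sigma$ with free variables in $V$; (2) $\mathcal{L}_1\vee\mathcal{L}_2=\{\phi_1\vee\phi_2\mid\phi_i\in\mathcal{L}_i\}$ with bottom $\bot_{\mathcal{L}_1}\vee\bot_{\mathcal{L}_2}$; (3) $\mathcal{L}_1\wedge\mathcal{L}_2=\{\phi_1\wedge\phi_2\mid\phi_i\in\mathcal{L}_i\}$ with bottom $\bot_{\mathcal{L}_1}\wedge\bot_{\mathcal{L}_2}$; (4) for $k\in\mathbb{N}$, $\bigvee_k\mathcal{L}=\{\bigvee\bar\phi\mid\bar\phi\in\mathcal{L}^*,|\bar\phi|\le k\}$ with bottom $\bigvee\epsilon$; (5) $\bigwedge_\omega\mathcal{L}=\{\bigwedge\bar\phi\mid\bar\phi\in\mathcal{L}^*,\bar\phi\neq\epsilon\}$ with bottom $\bigwedge\langle\bot_{\mathcal{L}}\rangle$; (6) $\exists_X\mathcal{L}=\{\exists X.\phi\mid\phi\in\mathcal{L}\}$ with bottom $\exists X.\bot_{\mathcal{L}}$; (7) $\forall_X\mathcal{L}=\{\forall X.\phi\mid\phi\in\mathcal{L}\}$ with bottom $\forall X.\bot_{\mathcal{L}}$;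 (8) $\exists\forall_X\mathcal{L}=\{QX.\phi\mid\phi\in\mathcal{L},Q\in\{\exists,\forall\}\}$ with bottom $\forall X.\bot_{\mathcal{L}}$. These constructions are syntactic (e.g. $\phi_1\vee\phi_2$ and $\bigvee\langle\phi_1,\phi_2\rangle$ are different formulas). Subsumption $\sqsubseteq_{\mathcal{L}}$ is defined inductively ($\circ\in\{\vee,\wedge\}$, $Q,Q'\in\{\exists,\forall\}$): $\phi\sqsubseteq_{\mathcal{L}_A}\psi$ iff $\phi=\bot$ or $\phi=\psi$; $\phi_1\circ\phi_2\sqsubseteq_{\mathcal{L}_1\circ\mathcal{L}_2}\psi_1\circ\psi_2$ iff $\phi_1\sqsubseteq_{\mathcal{L}_1}\psi_1$ and $\phi_2\sqsubseteq_{\mathcal{L}_2}\psi_2$; $\bigvee\bar\phi\sqsubseteq_{\bigvee_k\mathcal{L}}\bigvee\bar\psi$ iff there is an injective $m:[\bar\phi]\to[\bar\psi]$ with $\phi_i\sqsubseteq_{\mathcal{L}}\psi_{m(i)}$ for all $i\in[\bar\phi]$; $\bigwedge\bar\phi\sqsubseteq_{\bigwedge_\omega\mathcal{L}}\bigwedge\bar\psi$ iff there is $m:[\bar\psi]\to[\bar\phi]$ with $\phi_{m(i)}\sqsubseteq_{\mathcal{L}}\psi_i$ for all $i\in[\bar\psi]$; for $Q\in\{\exists,\forall\}$, $QX.\phi\sqsubseteq_{Q_X\mathcal{L}}QX.\psi$ iff there is $\pi\in\mathfrak{S}_X$ with $\phi\sqsubseteq_{\mathcal{L}}\psi\pi$;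 $QX.\phi\sqsubseteq_{\exists\forall_X\mathcal{L}}Q'X.\psi$ iff there is $\pi\in\mathfrak{S}_X$ with $\phi\sqsubseteq_{\mathcal{L}}\psi\pi$, and ($Q=\forall$ or $Q'=\exists$). *)

theory Defs
  imports Main "HOL-Combinatorics.Permutations"
begin

section \<open>First-order formulas\<close>

record ('f, 'p) signature =
  fun_arity :: "'f \<rightharpoonup> nat"
  rel_arity :: "'p \<rightharpoonup> nat"

text \<open>
  A variable occurrence \<open>(x, k)\<close> refers to the variable named \<open>x\<close>, skipping the \<open>k\<close> innermost
  enclosing quantifiers that bind the name \<open>x\<close>. An ordinary named formula is one in which all
  those indices are \<open>0\<close>. Positive indices are only needed for what ordinary syntax cannot express
  without renaming a bound variable, namely an occurrence of \<open>x\<close> in the scope of a quantifier over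
  \<open>x\<close> that does not bind it. They make capture-avoiding substitution a total
  operation that never changes the bound variables: swapping \<open>x\<close> and \<open>y\<close> in \<open>\<exists>y. p(x, y)\<close> yields
  the formula \<open>\<exists>y. p((y, 1), (y, 0))\<close>, i.e. what is written \<open>\<exists>z. p(y, z)\<close> after renaming.
\<close>

type_synonym 'v var = "'v \<times> nat"

datatype ('f, 'v) trm = Var "'v var" | Fun 'f "('f, 'v) trm list"

datatype quant = Exists | Forall

text \<open>
  The binary connectives and the connectives on sequences are different constructors, since
  \<open>\<phi>\<^sub>1 \<or> \<phi>\<^sub>2\<close> and \<open>\<Or>\<langle>\<phi>\<^sub>1, \<phi>\<^sub>2\<rangle>\<close> have to be different formulas.
\<close>

datatype ('f, 'p, 'v) fm =
    Bot
  | Rel 'p "('f, 'v) trm list"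
  | Eq "('f, 'v) trm" "('f, 'v) trm"
  | Neg "('f, 'p, 'v) fm"
  | Or "('f, 'p, 'v) fm" "('f, 'p, 'v) fm"
  | And "('f, 'p, 'v) fm" "('f, 'p, 'v) fm"
  | BigOr "('f, 'p, 'v) fm list"
  | BigAnd "('f, 'p, 'v) fm list"
  | Quant quant "'v set" "('f, 'p, 'v) fm"

fun trm_over :: "('f, 'p) signature \<Rightarrow> ('f, 'v) trm \<Rightarrow> bool" where
  "trm_over S (Var v) \<longleftrightarrow> True"
| "trm_over S (Fun f ts) \<longleftrightarrow> fun_arity S f = Some (length ts) \<and> (\<forall>t\<in>set ts. trm_over S t)"

fun fm_over :: "('f, 'p) signature \<Rightarrow> ('f, 'p, 'v) fm \<Rightarrow> bool" where
  "fm_over S Bot \<longleftrightarrow> True"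
| "fm_over S (Rel p ts) \<longleftrightarrow> rel_arity S p = Some (length ts) \<and> (\<forall>t\<in>set ts. trm_over S t)"
| "fm_over S (Eq t u) \<longleftrightarrow> trm_over S t \<and> trm_over S u"
| "fm_over S (Neg \<phi>) \<longleftrightarrow> fm_over S \<phi>"
| "fm_over S (Or \<phi> \<psi>) \<longleftrightarrow> fm_over S \<phi> \<and> fm_over S \<psi>"
| "fm_over S (And \<phi> \<psi>) \<longleftrightarrow> fm_over S \<phi> \<and> fm_over S \<psi>"
| "fm_over S (BigOr \<phi>s) \<longleftrightarrow> (\<forall>\<phi>\<in>set \<phi>s. fm_over S \<phi>)"
| "fm_over S (BigAnd \<phi>s) \<longleftrightarrow> (\<forall>\<phi>\<in>set \<phi>s. fm_over S \<phi>)"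
| "fm_over S (Quant q X \<phi>) \<longleftrightarrow> finite X \<and> fm_over S \<phi>"

text \<open>
  \<open>shift X v\<close> is how the variable \<open>v\<close> from outside a quantifier over \<open>X\<close> is written inside its scope.
\<close>

fun shift :: "'v set \<Rightarrow> 'v var \<Rightarrow> 'v var" where
  "shift X (x, k) = (x, if x \<in> X then Suc k else k)"

fun trm_vars :: "('f, 'v) trm \<Rightarrow> 'v var set" where
  "trm_vars (Var v) = {v}"
| "trm_vars (Fun f ts) = (\<Union>t\<in>set ts. trm_vars t)"

fun free_vars :: "('f, 'p, 'v) fm \<Rightarrow> 'v var set" where
  "free_vars Bot = {}"
| "free_vars (Rel p ts) = (\<Union>t\<in>set ts. trm_vars t)"
| "free_vars (Eq t u) = trm_vars t \<union> trm_vars u"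
| "free_vars (Neg \<phi>) = free_vars \<phi>"
| "free_vars (Or \<phi> \<psi>) = free_vars \<phi> \<union> free_vars \<psi>"
| "free_vars (And \<phi> \<psi>) = free_vars \<phi> \<union> free_vars \<psi>"
| "free_vars (BigOr \<phi>s) = (\<Union>\<phi>\<in>set \<phi>s. free_vars \<phi>)"
| "free_vars (BigAnd \<phi>s) = (\<Union>\<phi>\<in>set \<phi>s. free_vars \<phi>)"
| "free_vars (Quant q X \<phi>) = {v. shift X v \<in> free_vars \<phi>}"


section \<open>Substitution of free variables\<close>

fun trm_rename :: "('v var \<Rightarrow> 'v var) \<Rightarrow> ('f, 'v) trm \<Rightarrow> ('f, 'v) trm" where
  "trm_rename r (Var v) = Var (r v)"
| "trm_rename r (Fun f ts) = Fun f (map (trm_rename r) ts)"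

text \<open>
  \<open>lift X r\<close> acts inside the scope of a quantifier over \<open>X\<close> as \<open>r\<close> acts outside: the variables bound
  by that quantifier are kept.
\<close>

fun lift :: "'v set \<Rightarrow> ('v var \<Rightarrow> 'v var) \<Rightarrow> 'v var \<Rightarrow> 'v var" where
  "lift X r (x, k) =
     (if x \<in> X then (case k of 0 \<Rightarrow> (x, 0) | Suc j \<Rightarrow> shift X (r (x, j))) else shift X (r (x, k)))"

fun rename :: "('v var \<Rightarrow> 'v var) \<Rightarrow> ('f, 'p, 'v) fm \<Rightarrow> ('f, 'p, 'v) fm" where
  "rename r Bot = Bot"
| "rename r (Rel p ts) = Rel p (map (trm_rename r) ts)"
| "rename r (Eq t u) = Eq (trm_rename r t) (trm_rename r u)"
| "rename r (Neg \<phi>) = Neg (rename r \<phi>)"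
| "rename r (Or \<phi> \<psi>) = Or (rename r \<phi>) (rename r \<psi>)"
| "rename r (And \<phi> \<psi>) = And (rename r \<phi>) (rename r \<psi>)"
| "rename r (BigOr \<phi>s) = BigOr (map (rename r) \<phi>s)"
| "rename r (BigAnd \<phi>s) = BigAnd (map (rename r) \<phi>s)"
| "rename r (Quant q X \<phi>) = Quant q X (rename (lift X r) \<phi>)"

text \<open>\<open>perm_subst \<pi> \<phi>\<close> is \<open>\<phi>\<pi>\<close>. Where \<open>\<pi>\<close> is the identity, nothing is substituted.\<close>

definition perm_subst :: "('v \<Rightarrow> 'v) \<Rightarrow> ('f, 'p, 'v) fm \<Rightarrow> ('f, 'p, 'v) fm" where
  "perm_subst \<pi> \<phi> = rename (\<lambda>(x, k). if k = 0 then (\<pi> x, 0) else (x, k)) \<phi>"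

definition perm_closed :: "'v set \<Rightarrow> ('f, 'p, 'v) fm set \<Rightarrow> bool" where
  "perm_closed V F \<longleftrightarrow>
     (\<forall>\<phi>\<in>F. \<forall>X \<pi>. finite X \<and> X \<subseteq> V \<and> \<pi> permutes X \<longrightarrow> perm_subst \<pi> \<phi> \<in> F)"


section \<open>Semantics\<close>

record ('f, 'p, 'u) struct =
  universe :: "'u set"
  fun_interp :: "'f \<Rightarrow> 'u list \<Rightarrow> 'u"
  rel_interp :: "'p \<Rightarrow> 'u list \<Rightarrow> bool"

type_synonym ('f, 'p, 'v, 'u) state = "('f, 'p, 'u) struct \<times> ('v \<Rightarrow> 'u)"

text \<open>The universe of a state is nonempty, because the assignment takes values in it.\<close>

definition is_state :: "('f, 'p) signature \<Rightarrow> ('f, 'p, 'v, 'u) state \<Rightarrow> bool" where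
  "is_state S s \<longleftrightarrow>
     (case s of (M, \<mu>) \<Rightarrow>
        finite (universe M) \<and>
        (\<forall>f us. fun_arity S f = Some (length us) \<and> set us \<subseteq> universe M
           \<longrightarrow> fun_interp M f us \<in> universe M) \<and>
        (\<forall>x. \<mu> x \<in> universe M))"

fun trm_val :: "('f, 'p, 'u) struct \<Rightarrow> ('v var \<Rightarrow> 'u) \<Rightarrow> ('f, 'v) trm \<Rightarrow> 'u" where
  "trm_val M e (Var v) = e v"
| "trm_val M e (Fun f ts) = fun_interp M f (map (trm_val M e) ts)"

text \<open>\<open>bind_vars X u e\<close> is the assignment in the scope of a quantifier over \<open>X\<close> whose variables take
  the values \<open>u\<close>.\<close>

fun bind_vars :: "'v set \<Rightarrow> ('v \<Rightarrow> 'u) \<Rightarrow> ('v var \<Rightarrow> 'u) \<Rightarrow> 'v var \<Rightarrow> 'u" where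
  "bind_vars X u e (x, k) =
     (if x \<in> X then (case k of 0 \<Rightarrow> u x | Suc j \<Rightarrow> e (x, j)) else e (x, k))"

fun holds :: "('f, 'p, 'u) struct \<Rightarrow> ('v var \<Rightarrow> 'u) \<Rightarrow> ('f, 'p, 'v) fm \<Rightarrow> bool" where
  "holds M e Bot \<longleftrightarrow> False"
| "holds M e (Rel p ts) \<longleftrightarrow> rel_interp M p (map (trm_val M e) ts)"
| "holds M e (Eq t u) \<longleftrightarrow> trm_val M e t = trm_val M e u"
| "holds M e (Neg \<phi>) \<longleftrightarrow> \<not> holds M e \<phi>"
| "holds M e (Or \<phi> \<psi>) \<longleftrightarrow> holds M e \<phi> \<or> holds M e \<psi>"
| "holds M e (And \<phi> \<psi>) \<longleftrightarrow> holds M e \<phi> \<and> holds M e \<psi>"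
| "holds M e (BigOr \<phi>s) \<longleftrightarrow> (\<exists>\<phi>\<in>set \<phi>s. holds M e \<phi>)"
| "holds M e (BigAnd \<phi>s) \<longleftrightarrow> (\<forall>\<phi>\<in>set \<phi>s. holds M e \<phi>)"
| "holds M e (Quant Exists X \<phi>) \<longleftrightarrow>
     (\<exists>u. u ` X \<subseteq> universe M \<and> holds M (bind_vars X u e) \<phi>)"
| "holds M e (Quant Forall X \<phi>) \<longleftrightarrow>
     (\<forall>u. u ` X \<subseteq> universe M \<longrightarrow> holds M (bind_vars X u e) \<phi>)"

text \<open>
  The formulas of a bounded language over \<open>V\<close> have free variables \<open>(x, 0)\<close> only, so the value chosen
  here for a free variable with a positive index does not matter for them.
\<close>

definition sat :: "('f, 'p, 'v, 'u) state \<Rightarrow> ('f, 'p, 'v) fm \<Rightarrow> bool" where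
  "sat s \<phi> \<longleftrightarrow> holds (fst s) (\<lambda>(x, k). snd s x) \<phi>"


section \<open>Bounded languages\<close>

text \<open>
  The bottom formula and the subsumption relation depend on how a language is constructed, hence
  languages are represented by their constructions; \<open>language L\<close> is the set of formulas.
\<close>

datatype ('f, 'p, 'v) lang =
    LBase "('f, 'p, 'v) fm set"
  | LOr "('f, 'p, 'v) lang" "('f, 'p, 'v) lang"
  | LAnd "('f, 'p, 'v) lang" "('f, 'p, 'v) lang"
  | LBigOr nat "('f, 'p, 'v) lang"
  | LBigAnd "('f, 'p, 'v) lang"
  | LQuant quant "'v set" "('f, 'p, 'v) lang"
  | LAnyQuant "'v set" "('f, 'p, 'v) lang"

fun bounded_language :: "('f, 'p) signature \<Rightarrow> 'v set \<Rightarrow> ('f, 'p, 'v) lang \<Rightarrow> bool" where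
  "bounded_language S V (LBase A) \<longleftrightarrow>
     finite A \<and> perm_closed V A \<and> (\<forall>\<phi>\<in>A. fm_over S \<phi> \<and> free_vars \<phi> \<subseteq> V \<times> {0})"
| "bounded_language S V (LOr L\<^sub>1 L\<^sub>2) \<longleftrightarrow> bounded_language S V L\<^sub>1 \<and> bounded_language S V L\<^sub>2"
| "bounded_language S V (LAnd L\<^sub>1 L\<^sub>2) \<longleftrightarrow> bounded_language S V L\<^sub>1 \<and> bounded_language S V L\<^sub>2"
| "bounded_language S V (LBigOr k L) \<longleftrightarrow> bounded_language S V L"
| "bounded_language S V (LBigAnd L) \<longleftrightarrow> bounded_language S V L"
| "bounded_language S V (LQuant q X L) \<longleftrightarrow> finite X \<and> X \<subseteq> V \<and> bounded_language S V L"
| "bounded_language S V (LAnyQuant X L) \<longleftrightarrow> finite X \<and> X \<subseteq> V \<and> bounded_language S V L"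

fun language :: "('f, 'p, 'v) lang \<Rightarrow> ('f, 'p, 'v) fm set" where
  "language (LBase A) = A \<union> {Bot}"
| "language (LOr L\<^sub>1 L\<^sub>2) = {Or \<phi>\<^sub>1 \<phi>\<^sub>2 | \<phi>\<^sub>1 \<phi>\<^sub>2. \<phi>\<^sub>1 \<in> language L\<^sub>1 \<and> \<phi>\<^sub>2 \<in> language L\<^sub>2}"
| "language (LAnd L\<^sub>1 L\<^sub>2) = {And \<phi>\<^sub>1 \<phi>\<^sub>2 | \<phi>\<^sub>1 \<phi>\<^sub>2. \<phi>\<^sub>1 \<in> language L\<^sub>1 \<and> \<phi>\<^sub>2 \<in> language L\<^sub>2}"
| "language (LBigOr k L) = {BigOr \<phi>s | \<phi>s. set \<phi>s \<subseteq> language L \<and> length \<phi>s \<le> k}"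
| "language (LBigAnd L) = {BigAnd \<phi>s | \<phi>s. set \<phi>s \<subseteq> language L \<and> \<phi>s \<noteq> []}"
| "language (LQuant q X L) = {Quant q X \<phi> | \<phi>. \<phi> \<in> language L}"
| "language (LAnyQuant X L) = {Quant q X \<phi> | q \<phi>. \<phi> \<in> language L}"

fun bottom :: "('f, 'p, 'v) lang \<Rightarrow> ('f, 'p, 'v) fm" where
  "bottom (LBase A) = Bot"
| "bottom (LOr L\<^sub>1 L\<^sub>2) = Or (bottom L\<^sub>1) (bottom L\<^sub>2)"
| "bottom (LAnd L\<^sub>1 L\<^sub>2) = And (bottom L\<^sub>1) (bottom L\<^sub>2)"
| "bottom (LBigOr k L) = BigOr []"
| "bottom (LBigAnd L) = BigAnd [bottom L]"
| "bottom (LQuant q X L) = Quant q X (bottom L)"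
| "bottom (LAnyQuant X L) = Quant Forall X (bottom L)"


section \<open>Subsumption\<close>

text \<open>
  Positions in a sequence are counted from \<open>0\<close>. Membership in the language is not part of the
  relation: if a name of \<open>X\<close> is bound again inside \<open>L\<close>, then \<open>\<psi>\<pi>\<close> need not be in \<open>language L\<close> even for
  \<open>\<psi> \<in> language L\<close>, as \<open>\<pi>\<close> can move a free variable to a name that the inner quantifier binds, and the
  relation must still be defined there.
\<close>

inductive subsumes :: "('f, 'p, 'v) lang \<Rightarrow> ('f, 'p, 'v) fm \<Rightarrow> ('f, 'p, 'v) fm \<Rightarrow> bool" where
  base: "\<phi> = Bot \<or> \<phi> = \<psi> \<Longrightarrow> subsumes (LBase A) \<phi> \<psi>"
| disj: "\<lbrakk>subsumes L\<^sub>1 \<phi>\<^sub>1 \<psi>\<^sub>1; subsumes L\<^sub>2 \<phi>\<^sub>2 \<psi>\<^sub>2\<rbrakk>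
    \<Longrightarrow> subsumes (LOr L\<^sub>1 L\<^sub>2) (Or \<phi>\<^sub>1 \<phi>\<^sub>2) (Or \<psi>\<^sub>1 \<psi>\<^sub>2)"
| conj: "\<lbrakk>subsumes L\<^sub>1 \<phi>\<^sub>1 \<psi>\<^sub>1; subsumes L\<^sub>2 \<phi>\<^sub>2 \<psi>\<^sub>2\<rbrakk>
    \<Longrightarrow> subsumes (LAnd L\<^sub>1 L\<^sub>2) (And \<phi>\<^sub>1 \<phi>\<^sub>2) (And \<psi>\<^sub>1 \<psi>\<^sub>2)"
| big_or: "\<lbrakk>m ` {..<length \<phi>s} \<subseteq> {..<length \<psi>s}; inj_on m {..<length \<phi>s};
      \<forall>i<length \<phi>s. subsumes L (\<phi>s ! i) (\<psi>s ! m i)\<rbrakk>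
    \<Longrightarrow> subsumes (LBigOr k L) (BigOr \<phi>s) (BigOr \<psi>s)"
| big_and: "\<lbrakk>m ` {..<length \<psi>s} \<subseteq> {..<length \<phi>s};
      \<forall>i<length \<psi>s. subsumes L (\<phi>s ! m i) (\<psi>s ! i)\<rbrakk>
    \<Longrightarrow> subsumes (LBigAnd L) (BigAnd \<phi>s) (BigAnd \<psi>s)"
| quant: "\<lbrakk>\<pi> permutes X; subsumes L \<phi> (perm_subst \<pi> \<psi>)\<rbrakk>
    \<Longrightarrow> subsumes (LQuant q X L) (Quant q X \<phi>) (Quant q X \<psi>)"
| any_quant: "\<lbrakk>\<pi> permutes X; subsumes L \<phi> (perm_subst \<pi> \<psi>); q = Forall \<or> q' = Exists\<rbrakk>
    \<Longrightarrow> subsumes (LAnyQuant X L) (Quant q X \<phi>) (Quant q' X \<psi>)"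

end

(*
  Subsumption is preserved by every renaming of free variables, because the permutation chosen at a
  quantifier over X moves only variables bound there, while a renaming lifted under that quantifier
  fixes exactly those and never hits them; so the two commute. This turns \<phi> \<sqsubseteq> \<psi>\<pi> and \<psi> \<sqsubseteq> \<chi>\<sigma> into
  \<phi> \<sqsubseteq> \<psi>\<pi> \<sqsubseteq> (\<chi>\<sigma>)\<pi>, which gives transitivity at quantifiers. Soundness holds because \<psi>\<pi> under a choice
  of values u for X means \<psi> under u \<circ> \<pi>, and u \<mapsto> u \<circ> \<pi> is a bijection on such choices.
*)
theory Submission
  imports Defs
begin

section \<open>Renamings under quantifiers and the permutations at a quantifier\<close>

lemma lift_shift: "lift X r (shift X v) = shift X (r v)"
  by (cases v) simp

text \<open>A lifted renaming fixes the bound variables and sends outside variables to outside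
  variables, so lifted renamings compose without interference. This is the quantifier case of
  \<open>rename_comp\<close>.\<close>

lemma lift_comp: "lift X (r \<circ> s) = lift X r \<circ> lift X s"
proof
  fix v
  show "lift X (r \<circ> s) v = (lift X r \<circ> lift X s) v"
    by (cases v) (auto simp: lift_shift simp del: shift.simps split: nat.split)
qed

lemma lift_id: "lift X (\<lambda>v. v) = (\<lambda>v. v)"
proof
  fix v
  show "lift X (\<lambda>v. v) v = v"
    by (cases v) (auto split: nat.split)
qed

lemma trm_rename_comp: "trm_rename r (trm_rename s t) = trm_rename (r \<circ> s) t"
  by (induction t) auto

lemma trm_rename_id: "trm_rename (\<lambda>v. v) t = t"
  by (induction t) (auto simp: map_idI)

lemma rename_comp: "rename r (rename s \<phi>) = rename (r \<circ> s) \<phi>"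
  by (induction \<phi> arbitrary: r s) (auto simp: trm_rename_comp lift_comp)

lemma rename_id: "rename (\<lambda>v. v) \<phi> = \<phi>"
  by (induction \<phi>) (auto simp: trm_rename_id lift_id map_idI)

text \<open>The renaming inside \<open>perm_subst\<close>, isolated so that composition and
  commutation can be proved on variables before being carried over to formulas.\<close>

definition perm_var :: "('v \<Rightarrow> 'v) \<Rightarrow> 'v var \<Rightarrow> 'v var" where
  "perm_var \<pi> = (\<lambda>(x, k). if k = 0 then (\<pi> x, 0) else (x, k))"

lemma perm_subst_eq_rename: "perm_subst \<pi> \<phi> = rename (perm_var \<pi>) \<phi>"
  by (simp add: perm_subst_def perm_var_def)

lemma perm_subst_id: "perm_subst id (\<phi> :: ('f, 'p, 'v) fm) = \<phi>"
proof -
  have "perm_var (id :: 'v \<Rightarrow> 'v) = (\<lambda>v. v)"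
    by (auto simp: perm_var_def fun_eq_iff)
  then show ?thesis
    by (simp only: perm_subst_eq_rename rename_id)
qed

lemma perm_subst_comp: "perm_subst \<pi> (perm_subst \<sigma> \<phi>) = perm_subst (\<pi> \<circ> \<sigma>) \<phi>"
proof -
  have "perm_var \<pi> \<circ> perm_var \<sigma> = perm_var (\<pi> \<circ> \<sigma>)"
    by (auto simp: perm_var_def fun_eq_iff)
  then show ?thesis
    by (simp add: perm_subst_eq_rename rename_comp)
qed

text \<open>A shifted variable has either a name outside \<open>X\<close>, which \<pi> fixes, or a
  positive index, which \<open>perm_var\<close> ignores.\<close>

lemma perm_var_shift:
  assumes "\<pi> permutes X"
  shows "perm_var \<pi> (shift X v) = shift X v"
  by (cases v) (auto simp: perm_var_def permutes_not_in[OF assms])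

lemma lift_perm_var_commute:
  assumes "\<pi> permutes X"
  shows "lift X r \<circ> perm_var \<pi> = perm_var \<pi> \<circ> lift X r"
proof
  fix v :: "'a var"
  obtain x k where v: "v = (x, k)"
    by (cases v)
  show "(lift X r \<circ> perm_var \<pi>) v = (perm_var \<pi> \<circ> lift X r) v"
  proof (cases "x \<in> X \<and> k = 0")
    case True
    then show ?thesis
      by (simp add: v perm_var_def permutes_in_image[OF assms])
  next
    case False
    \<comment> \<open>Every variable other than a bound one comes from outside the quantifier: a
      name in \<open>X\<close> has a positive index here, so \<open>k - 1\<close> undoes the
      successor added by \<open>shift\<close>.\<close>
    then have "v = shift X (x, if x \<in> X then k - 1 else k)"
      by (auto simp: v)
    then obtain w where "v = shift X w" ..
    then show ?thesis
      by (simp add: perm_var_shift[OF assms] lift_shift)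
  qed
qed

lemma perm_subst_rename_lift:
  assumes "\<pi> permutes X"
  shows "rename (lift X r) (perm_subst \<pi> \<phi>) = perm_subst \<pi> (rename (lift X r) \<phi>)"
  by (simp add: perm_subst_eq_rename rename_comp lift_perm_var_commute[OF assms])

section \<open>Subsumption as a preorder with a least element\<close>

text \<open>The claim covers all renamings because the induction passes under quantifiers, where a
  permutation turns into a lifted renaming that can also move variables of positive index.\<close>

lemma subsumes_rename:
  "subsumes L \<phi> \<psi> \<Longrightarrow> subsumes L (rename r \<phi>) (rename r \<psi>)"
proof (induction arbitrary: r rule: subsumes.induct)
  case (base \<phi> \<psi> A)
  then show ?case
    by (auto intro: subsumes.base)
next
  case (big_or m \<phi>s \<psi>s L k)
  then show ?case
    by (auto intro!: subsumes.big_or[where m = m] simp: image_subset_iff)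
next
  case (big_and m \<psi>s \<phi>s L)
  then show ?case
    by (auto intro!: subsumes.big_and[where m = m] simp: image_subset_iff)
next
  case (quant \<pi> X L \<phi> \<psi> q)
  then show ?case
    by (auto intro!: subsumes.quant simp: perm_subst_rename_lift[symmetric])
next
  case (any_quant \<pi> X L \<phi> \<psi> q q')
  then show ?case
    by (auto intro!: subsumes.any_quant simp: perm_subst_rename_lift[symmetric])
qed (auto intro: subsumes.intros)

lemma subsumes_perm_subst:
  "subsumes L \<phi> \<psi> \<Longrightarrow> subsumes L (perm_subst \<pi> \<phi>) (perm_subst \<pi> \<psi>)"
  by (simp add: perm_subst_eq_rename subsumes_rename)

lemma subsumes_refl: "\<phi> \<in> language L \<Longrightarrow> subsumes L \<phi> \<phi>"
proof (induction L arbitrary: \<phi>)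
  case (LBigOr k L)
  then show ?case
    by (auto intro!: subsumes.big_or[where m = id] simp: subset_iff)
next
  case (LBigAnd L)
  then show ?case
    by (auto intro!: subsumes.big_and[where m = id] simp: subset_iff)
next
  case (LQuant q X L)
  then show ?case
    by (auto intro!: subsumes.quant[OF permutes_id] simp: perm_subst_id)
next
  case (LAnyQuant X L)
  then show ?case
    \<comment> \<open>With equal quantifiers the side condition says that \<open>q\<close> is
      \<open>Forall\<close> or \<open>Exists\<close>, which is case exhaustion.\<close>
    by (auto intro!: subsumes.any_quant[OF permutes_id] simp: perm_subst_id intro: quant.exhaust)
qed (auto intro: subsumes.intros)

text \<open>Arbitrary formulas are allowed because the induction hypothesis is applied to formulas
  such as \<beta>\<pi>, which may lie outside the language. Induction on \<open>L\<close> fixes the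
  rule by which both subsumptions were derived.\<close>

lemma subsumes_trans:
  "subsumes L \<phi> \<psi> \<Longrightarrow> subsumes L \<psi> \<chi> \<Longrightarrow> subsumes L \<phi> \<chi>"
proof (induction L arbitrary: \<phi> \<psi> \<chi>)
  case (LBase A)
  then show ?case
    by (auto elim!: subsumes.cases[of "LBase A"] intro!: subsumes.base)
next
  case (LOr L\<^sub>1 L\<^sub>2)
  from LOr.prems(1) show ?case
  proof cases
    case (disj \<phi>\<^sub>1 \<psi>\<^sub>1 \<phi>\<^sub>2 \<psi>\<^sub>2)
    from LOr.prems(2)[unfolded disj(2)] show ?thesis
      by cases (auto simp: disj(1) intro!: subsumes.disj LOr.IH(1)[OF disj(3)] LOr.IH(2)[OF disj(4)])
  qed
next
  case (LAnd L\<^sub>1 L\<^sub>2)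
  from LAnd.prems(1) show ?case
  proof cases
    case (conj \<phi>\<^sub>1 \<psi>\<^sub>1 \<phi>\<^sub>2 \<psi>\<^sub>2)
    from LAnd.prems(2)[unfolded conj(2)] show ?thesis
      by cases (auto simp: conj(1) intro!: subsumes.conj LAnd.IH(1)[OF conj(3)] LAnd.IH(2)[OF conj(4)])
  qed
next
  case (LBigOr k L)
  from LBigOr.prems(1) obtain m \<phi>s \<psi>s where
    \<phi>: "\<phi> = BigOr \<phi>s" and \<psi>: "\<psi> = BigOr \<psi>s" and
    m: "m ` {..<length \<phi>s} \<subseteq> {..<length \<psi>s}" "inj_on m {..<length \<phi>s}"
      "\<forall>i<length \<phi>s. subsumes L (\<phi>s ! i) (\<psi>s ! m i)"
    by (auto elim: subsumes.cases)
  from LBigOr.prems(2) obtain n \<chi>s where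
    \<chi>: "\<chi> = BigOr \<chi>s" and
    n: "n ` {..<length \<psi>s} \<subseteq> {..<length \<chi>s}" "inj_on n {..<length \<psi>s}"
      "\<forall>i<length \<psi>s. subsumes L (\<psi>s ! i) (\<chi>s ! n i)"
    unfolding \<psi> by (auto elim: subsumes.cases)
  show ?case
    unfolding \<phi> \<chi>
  proof (rule subsumes.big_or)
    show "(n \<circ> m) ` {..<length \<phi>s} \<subseteq> {..<length \<chi>s}"
      using m(1) n(1) by auto
    show "inj_on (n \<circ> m) {..<length \<phi>s}"
      using comp_inj_on m(2) inj_on_subset[OF n(2) m(1)] by blast
    show "\<forall>i<length \<phi>s. subsumes L (\<phi>s ! i) (\<chi>s ! (n \<circ> m) i)"
      using m(1,3) n(3) LBigOr.IH by (auto simp: image_subset_iff)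
  qed
next
  case (LBigAnd L)
  from LBigAnd.prems(1) obtain m \<phi>s \<psi>s where
    \<phi>: "\<phi> = BigAnd \<phi>s" and \<psi>: "\<psi> = BigAnd \<psi>s" and
    m: "m ` {..<length \<psi>s} \<subseteq> {..<length \<phi>s}"
      "\<forall>i<length \<psi>s. subsumes L (\<phi>s ! m i) (\<psi>s ! i)"
    by (auto elim: subsumes.cases)
  from LBigAnd.prems(2) obtain n \<chi>s where
    \<chi>: "\<chi> = BigAnd \<chi>s" and
    n: "n ` {..<length \<chi>s} \<subseteq> {..<length \<psi>s}"
      "\<forall>i<length \<chi>s. subsumes L (\<psi>s ! n i) (\<chi>s ! i)"
    unfolding \<psi> by (auto elim: subsumes.cases)
  show ?case
    unfolding \<phi> \<chi>
  proof (rule subsumes.big_and)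
    \<comment> \<open>Index maps for conjunctions run from the right sequence to the left one, so
      they compose in the opposite order to those for disjunctions.\<close>
    show "(m \<circ> n) ` {..<length \<chi>s} \<subseteq> {..<length \<phi>s}"
      using m(1) n(1) by auto
    show "\<forall>i<length \<chi>s. subsumes L (\<phi>s ! (m \<circ> n) i) (\<chi>s ! i)"
      using m(2) n LBigAnd.IH by (auto simp: image_subset_iff)
  qed
next
  case (LQuant q X L)
  from LQuant.prems(1) obtain \<pi> \<alpha> \<beta> where
    \<phi>: "\<phi> = Quant q X \<alpha>" and \<psi>: "\<psi> = Quant q X \<beta>" and
    \<pi>: "\<pi> permutes X" "subsumes L \<alpha> (perm_subst \<pi> \<beta>)"
    by (auto elim: subsumes.cases)
  from LQuant.prems(2) obtain \<sigma> \<gamma> where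
    \<chi>: "\<chi> = Quant q X \<gamma>" and
    \<sigma>: "\<sigma> permutes X" "subsumes L \<beta> (perm_subst \<sigma> \<gamma>)"
    unfolding \<psi> by (auto elim: subsumes.cases)
  have "subsumes L \<alpha> (perm_subst (\<pi> \<circ> \<sigma>) \<gamma>)"
    using LQuant.IH[OF \<pi>(2) subsumes_perm_subst[OF \<sigma>(2)]] by (simp add: perm_subst_comp)
  then show ?case
    unfolding \<phi> \<chi> by (rule subsumes.quant[OF permutes_compose[OF \<sigma>(1) \<pi>(1)]])
next
  case (LAnyQuant X L)
  from LAnyQuant.prems(1) obtain \<pi> \<alpha> \<beta> q q' where
    \<phi>: "\<phi> = Quant q X \<alpha>" and \<psi>: "\<psi> = Quant q' X \<beta>" and
    \<pi>: "\<pi> permutes X" "subsumes L \<alpha> (perm_subst \<pi> \<beta>)" and q: "q = Forall \<or> q' = Exists"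
    by (auto elim: subsumes.cases)
  from LAnyQuant.prems(2) obtain \<sigma> \<gamma> q'' where
    \<chi>: "\<chi> = Quant q'' X \<gamma>" and
    \<sigma>: "\<sigma> permutes X" "subsumes L \<beta> (perm_subst \<sigma> \<gamma>)" and q': "q' = Forall \<or> q'' = Exists"
    unfolding \<psi> by (auto elim: subsumes.cases)
  have "subsumes L \<alpha> (perm_subst (\<pi> \<circ> \<sigma>) \<gamma>)"
    using LAnyQuant.IH[OF \<pi>(2) subsumes_perm_subst[OF \<sigma>(2)]] by (simp add: perm_subst_comp)
  \<comment> \<open>With \<open>Forall\<close> placed below \<open>Exists\<close>, the side
    condition is the order on a two-element chain, and this is its transitivity.\<close>
  moreover have "q = Forall \<or> q'' = Exists"
    using q q' by auto
  ultimately show ?case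
    unfolding \<phi> \<chi> by (rule subsumes.any_quant[OF permutes_compose[OF \<sigma>(1) \<pi>(1)]])
qed

lemma subsumes_bottom: "\<phi> \<in> language L \<Longrightarrow> subsumes L (bottom L) \<phi>"
proof (induction L arbitrary: \<phi>)
  case (LBigAnd L)
  then show ?case
    \<comment> \<open>The bottom conjunction has a single entry, at position 0, and that entry lies
      below every conjunct.\<close>
    by (auto intro!: subsumes.big_and[where m = "\<lambda>_. 0"] simp: subset_iff)
next
  case (LQuant q X L)
  then show ?case
    by (auto intro!: subsumes.quant[OF permutes_id] simp: perm_subst_id)
next
  case (LAnyQuant X L)
  then show ?case
    by (auto intro!: subsumes.any_quant[OF permutes_id] simp: perm_subst_id)
qed (auto intro: subsumes.intros)

section \<open>Semantics of renaming and soundness\<close>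

lemma bind_vars_shift: "bind_vars X u e (shift X v) = e v"
  by (cases v) simp

lemma bind_vars_lift: "bind_vars X u e \<circ> lift X r = bind_vars X u (e \<circ> r)"
proof
  fix v
  show "(bind_vars X u e \<circ> lift X r) v = bind_vars X u (e \<circ> r) v"
    by (cases v) (auto simp: bind_vars_shift simp del: shift.simps split: nat.split)
qed

text \<open>For \<open>x\<close> in \<open>X\<close>, \<pi> x is again in \<open>X\<close>, so
  \<open>(x, 0)\<close> receives the value of \<open>u\<close> at \<pi> x. At every other variable
  \<open>perm_var\<close> is the identity.\<close>

lemma bind_vars_perm_var:
  assumes "\<pi> permutes X"
  shows "bind_vars X u e \<circ> perm_var \<pi> = bind_vars X (u \<circ> \<pi>) e"
proof
  fix v
  show "(bind_vars X u e \<circ> perm_var \<pi>) v = bind_vars X (u \<circ> \<pi>) e v"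
    by (cases v) (auto simp: perm_var_def permutes_in_image[OF assms] permutes_not_in[OF assms]
        split: nat.split)
qed

lemma trm_val_rename: "trm_val M e (trm_rename r t) = trm_val M (e \<circ> r) t"
  by (induction t) (auto simp: comp_def cong: map_cong)

text \<open>The substitution lemma. It has no freshness conditions, since \<open>lift\<close>
  prevents capture; both \<open>e\<close> and \<open>r\<close> vary because a quantifier changes
  both.\<close>

lemma holds_rename: "holds M e (rename r \<phi>) \<longleftrightarrow> holds M (e \<circ> r) \<phi>"
proof (induction \<phi> arbitrary: e r)
  case (Rel p ts)
  have "map (trm_val M e) (map (trm_rename r) ts) = map (trm_val M (e \<circ> r)) ts"
    by (simp add: trm_val_rename)
  then show ?case
    by (simp only: rename.simps holds.simps)
next
  case (Quant q X \<phi>)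
  then show ?case
    by (cases q) (simp_all only: rename.simps holds.simps bind_vars_lift)
qed (auto simp: trm_val_rename)

lemma holds_bind_perm_subst:
  assumes "\<pi> permutes X"
  shows "holds M (bind_vars X u e) (perm_subst \<pi> \<phi>) \<longleftrightarrow> holds M (bind_vars X (u \<circ> \<pi>) e) \<phi>"
  by (simp add: perm_subst_eq_rename holds_rename bind_vars_perm_var[OF assms])

lemma holds_Quant_perm_subst:
  fixes M :: "('f, 'p, 'u) struct" and \<phi> :: "('f, 'p, 'v) fm"
  assumes "\<pi> permutes X"
  shows "holds M e (Quant q X (perm_subst \<pi> \<phi>)) \<longleftrightarrow> holds M e (Quant q X \<phi>)"
proof -
  \<comment> \<open>Reindexing by \<pi> preserves the condition that the chosen values lie in the
    universe.\<close>
  have img: "(u \<circ> \<pi>) ` X = u ` X" for u :: "'v \<Rightarrow> 'u"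
    by (simp only: image_comp[symmetric] permutes_image[OF assms])
  have reindex: "\<exists>w. u = w \<circ> \<pi>" for u :: "'v \<Rightarrow> 'u"
    by (rule exI[of _ "u \<circ> inv \<pi>"]) (simp only: comp_assoc permutes_inv_o(2)[OF assms] comp_id)
  have ex: "(\<exists>u. P (u \<circ> \<pi>)) \<longleftrightarrow> (\<exists>u. P u)" for P :: "('v \<Rightarrow> 'u) \<Rightarrow> bool"
    using reindex by metis
  have all: "(\<forall>u. P (u \<circ> \<pi>)) \<longleftrightarrow> (\<forall>u. P u)" for P :: "('v \<Rightarrow> 'u) \<Rightarrow> bool"
    using reindex by metis
  show ?thesis
  proof (cases q)
    case Exists
    then show ?thesis
      using ex[of "\<lambda>u. u ` X \<subseteq> universe M \<and> holds M (bind_vars X u e) \<phi>", unfolded img]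
      by (simp only: holds.simps holds_bind_perm_subst[OF assms])
  next
    case Forall
    then show ?thesis
      using all[of "\<lambda>u. u ` X \<subseteq> universe M \<longrightarrow> holds M (bind_vars X u e) \<phi>", unfolded img]
      by (simp only: holds.simps holds_bind_perm_subst[OF assms])
  qed
qed

lemma holds_Quant_mono:
  assumes "\<And>e. holds M e \<phi> \<Longrightarrow> holds M e \<psi>" and "holds M e (Quant q X \<phi>)"
  shows "holds M e (Quant q X \<psi>)"
  using assms by (cases q) auto

lemma holds_Exists_if_Forall:
  assumes "universe M \<noteq> {}" and "holds M e (Quant Forall X \<phi>)"
  shows "holds M e (Quant Exists X \<phi>)"
proof -
  obtain a where "a \<in> universe M"
    using assms(1) by blast
  \<comment> \<open>A constant choice instantiates the universal quantifier and then witnesses the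
    existential one.\<close>
  then have "(\<lambda>_. a) ` X \<subseteq> universe M"
    by auto
  then show ?thesis
    using assms(2) by auto
qed

text \<open>Assignments to indexed variables replace states here, because below a quantifier two
  occurrences of one name with different indices may have different values.\<close>

lemma subsumes_sound:
  assumes "subsumes L \<phi> \<psi>" and "universe M \<noteq> {}" and "holds M e \<phi>"
  shows "holds M e \<psi>"
  using assms(1,3)
proof (induction arbitrary: e rule: subsumes.induct)
  case (big_or m \<phi>s \<psi>s L k)
  then show ?case
    by (fastforce simp: in_set_conv_nth image_subset_iff)
next
  case (big_and m \<psi>s \<phi>s L)
  then show ?case
    by (fastforce simp: in_set_conv_nth image_subset_iff)
next
  case (quant \<pi> X L \<phi> \<psi> q)
  have "holds M e (Quant q X (perm_subst \<pi> \<psi>))"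
    using quant.IH quant.prems by (rule holds_Quant_mono)
  then show ?case
    by (simp only: holds_Quant_perm_subst[OF quant.hyps(1)])
next
  case (any_quant \<pi> X L \<phi> \<psi> q q')
  have "holds M e (Quant q X (perm_subst \<pi> \<psi>))"
    using any_quant.IH any_quant.prems by (rule holds_Quant_mono)
  then have "holds M e (Quant q X \<psi>)"
    by (simp only: holds_Quant_perm_subst[OF any_quant.hyps(1)])
  then show ?case
    \<comment> \<open>The side condition rules out passing from \<open>Exists\<close> to
      \<open>Forall\<close>; the only change of quantifier left is from \<open>Forall\<close> to
      \<open>Exists\<close>.\<close>
    using any_quant.hyps(3) holds_Exists_if_Forall[OF assms(2)] by (cases q; cases q') auto
qed auto

theorem theorem1:
  fixes S :: "('f, 'p) signature"
    and V :: "'v set"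
    and L :: "('f, 'p, 'v) lang"
  assumes "bounded_language S V L"
  shows "preorder_on (language L) {(\<phi>, \<psi>) \<in> language L \<times> language L. subsumes L \<phi> \<psi>}
    \<and> (\<forall>\<phi>\<in>language L. \<forall>\<psi>\<in>language L. subsumes L \<phi> \<psi> \<longrightarrow>
         (\<forall>s :: ('f, 'p, 'v, 'u) state. is_state S s \<longrightarrow> sat s \<phi> \<longrightarrow> sat s \<psi>))
    \<and> (\<forall>\<phi>\<in>language L. subsumes L (bottom L) \<phi>)"
proof (intro conjI ballI impI allI)
  show "preorder_on (language L) {(\<phi>, \<psi>) \<in> language L \<times> language L. subsumes L \<phi> \<psi>}"
    by (auto simp: preorder_on_def refl_on_def intro!: transI intro: subsumes_refl subsumes_trans)
next
  fix \<phi> \<psi> and s :: "('f, 'p, 'v, 'u) state"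
  assume sub: "subsumes L \<phi> \<psi>" and state: "is_state S s" and sat: "sat s \<phi>"
  \<comment> \<open>The value assigned to any variable is an element.\<close>
  have "universe (fst s) \<noteq> {}"
    using state by (auto simp: is_state_def)
  then show "sat s \<psi>"
    using sat unfolding sat_def by (rule subsumes_sound[OF sub])
next
  fix \<phi>
  assume "\<phi> \<in> language L"
  then show "subsumes L (bottom L) \<phi>"
    by (rule subsumes_bottom)
qed

end
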